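(* Let $q$ be a nonzero complex number with a fixed square root $q^{1/2}$, let $a,b$ be nonzero complex numbers, let $x$ be a complex number and let $n$ be a nonnegative integer. Assume that no zero factors appear in the denominators of the summand on the left-hand side below and that the denominators on the right-hand side are nonzero. Then $$ \begin{aligned} &{}_5\phi_4\left[\begin{matrix} q^{-n},\ qx,\ a,\ b,\ q^{3/2-n}/(ab)\\ x,\ q^{1-n}/a,\ q^{2-n}/b,\ q^{1/2}ab\end{matrix}\,\Big|\,q;q\right]\\ &\quad=\frac{(ab/q;q)_n}{(a;q)_n\,(b/q;q)_n}\cdot\frac{(a;q^{1/2})_n\,(b/q;q^{1/2})_n\,(-q^{1/2};q^{1/2})_n}{(ab/q;q^{1/2})_n}\cdot\frac{(q^{1/2}-ab)(q-bq^{n/2})}{(1-x)(q^{3/2}-ab^2q^n)}\\ &\qquad\times\left\{\frac{q^{1-n/2}-xbq^{n/2}}{q-b}-\frac{(q^{1/2}-bq^{n/2})(q^{1/2}x-ab)(q-abq^{n})}{(q^{1/2}-b)(q^{1/2}-abq^{n})(q-abq^{n/2})}\right\}. \end{aligned} $$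
   Context: For complex $y,p$: $(y;p)_0=1$ and $(y;p)_n=\prod_{i=0}^{n-1}(1-yp^i)$ for $n\ge 1$ (used with $p=q$ and with $p=q^{1/2}$). Half-integer powers of $q$ are powers of the fixed square root $q^{1/2}$; in particular $q^{n/2}=(q^{1/2})^n$. The basic hypergeometric series is $${}_{1+r}\phi_s\left[\begin{matrix} a_0,a_1,\dots,a_r\\ b_1,\dots,b_s\end{matrix}\,\Big|\,q;z\right]=\sum_{k=0}^{\infty}\frac{(a_0;q)_k(a_1;q)_k\cdots(a_r;q)_k}{(q;q)_k(b_1;q)_k\cdots(b_s;q)_k}\,z^k,$$ where the parameters are such that no zero factors appear in the denominators of the summand. When $q^{-n}$ is an upper parameter, all terms with $k>n$ vanish, so the series is the finite sum over $0\le k\le n$. *)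

theory Defs
  imports Complex_Main
begin

definition qpoch :: "complex \<Rightarrow> complex \<Rightarrow> nat \<Rightarrow> complex" where
  "qpoch y p n = (\<Prod>i<n. 1 - y * p ^ i)"

definition qhyp_denom :: "complex list \<Rightarrow> complex \<Rightarrow> nat \<Rightarrow> complex" where
  "qhyp_denom bs q k = qpoch q q k * (\<Prod>b\<leftarrow>bs. qpoch b q k)"

(* The basic hypergeometric series with upper parameters as and lower parameters bs.
   There is no factor ((-1)^k q^(k choose 2))^(1 + s - r): the series is used with r = s. *)
definition qhyp :: "complex list \<Rightarrow> complex list \<Rightarrow> complex \<Rightarrow> complex \<Rightarrow> complex" where
  "qhyp as bs q z = (\<Sum>k. (\<Prod>a\<leftarrow>as. qpoch a q k) / qhyp_denom bs q k * z ^ k)"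

end

theory Submission
  imports Defs "HOL-Computational_Algebra.Formal_Power_Series"
begin

text \<open>
  Write \<open>q = s\<^sup>2\<close> and \<open>e = a b / s\<close>. Reversing the four Pochhammer symbols whose arguments carry
  negative powers of \<open>q\<close> turns the \<open>k\<close>-th summand, up to a constant, into
  \<open>(a)\<^sub>k (a)\<^sub>n\<^sub>-\<^sub>k (b)\<^sub>k (b/q)\<^sub>n\<^sub>-\<^sub>k / ((q)\<^sub>k (q)\<^sub>n\<^sub>-\<^sub>k (e q)\<^sub>k (e)\<^sub>n\<^sub>-\<^sub>k s\<^sup>k)\<close> times \<open>1 - x q\<^sup>k\<close>. The last factor is
  a linear combination of \<open>1 - e q\<^sup>k\<close> and \<open>1 - q\<^sup>1\<^sup>-\<^sup>n q\<^sup>k / b\<close>, and each of these makes the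
  summand symmetric under \<open>k \<mapsto> n - k\<close> up to powers of \<open>s\<close>: the sum becomes a multiple of a convolution
  \<open>\<Sum>\<^sub>k U\<^sub>k U\<^sub>n\<^sub>-\<^sub>k s\<^sup>k\<close>, where \<open>U\<close> is the coefficient sequence of \<open>\<^sub>2\<phi>\<^sub>1(a, b'; a b' s)\<close> with
  \<open>b' = b/q\<close> in the first case and \<open>b' = b\<close> in the second. These convolutions are the
  coefficients of \<open>f(z) f(s z)\<close> for the generating function \<open>f\<close> of \<open>U\<close>, and they have a closed form
  by a \<open>q\<close>-analogue of Clausen's formula, which follows from the \<open>q\<close>-difference equation of \<open>f\<close>.
\<close>

section \<open>Pochhammer symbols: shifts, base change and reversal\<close>

lemma qpoch_0 [simp]: "qpoch y p 0 = 1"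
  by (simp add: qpoch_def)

lemma qpoch_Suc: "qpoch y p (Suc n) = qpoch y p n * (1 - y * p ^ n)"
  by (simp add: qpoch_def)

lemma qpoch_shift: "(1 - y) * qpoch (y * p) p n = qpoch y p n * (1 - y * p ^ n)"
proof (induction n)
  case (Suc n)
  have "(1 - y) * qpoch (y * p) p (Suc n) = ((1 - y) * qpoch (y * p) p n) * (1 - y * p ^ Suc n)"
    by (simp add: qpoch_Suc mult_ac)
  then show ?case
    by (simp only: Suc.IH qpoch_Suc)
qed simp

lemma qpoch_shift2:
  assumes "1 - y \<noteq> 0" "1 - y * p \<noteq> 0"
  shows "qpoch (y * p\<^sup>2) p n = qpoch y p n * (1 - y * p ^ n) * (1 - y * p * p ^ n) / ((1 - y) * (1 - y * p))"
proof -
  have "(1 - y) * (1 - y * p) * qpoch (y * p\<^sup>2) p n = (1 - y) * ((1 - y * p) * qpoch (y * p * p) p n)"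
    by (simp only: power2_eq_square mult.assoc)
  also have "\<dots> = (1 - y) * qpoch (y * p) p n * (1 - y * p * p ^ n)"
    unfolding qpoch_shift[of "y * p"] by (simp only: mult.assoc)
  also have "\<dots> = qpoch y p n * (1 - y * p ^ n) * (1 - y * p * p ^ n)"
    by (simp only: qpoch_shift)
  finally show ?thesis
    using assms by (simp add: nonzero_eq_divide_eq mult.commute)
qed

lemma qpoch_nonzero_le:
  assumes "qpoch y p n \<noteq> 0" "k \<le> n"
  shows "qpoch y p k \<noteq> 0"
  using assms by (auto simp: qpoch_def)

lemma qpoch_sq: "qpoch (s\<^sup>2) (s\<^sup>2) n = qpoch s s n * qpoch (- s) s n"
  by (induction n) (simp_all add: qpoch_Suc algebra_simps power2_eq_square power_mult_distrib)

text \<open>With w = q^(1-n+i), the factor 1 - w/y equals -(w/y) (1 - y/w), and 1/w = q^(n-1-i). So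
  the first k factors on the left are, up to -w/y, the last k factors of (y;q)_n. The product of the
  -w is independent of y and therefore cancels in quotients of such symbols.\<close>

lemma qpoch_reverse:
  assumes "q \<noteq> 0" "y \<noteq> 0" "k \<le> n"
  shows "qpoch (q powi (1 - int n) / y) q k * qpoch y q (n - k) * y ^ k
    = qpoch y q n * (\<Prod>i<k. - (q powi (1 - int n + int i)))"
  using assms(3)
proof (induction k)
  case (Suc k)
  define m where "m = n - Suc k"
  have m: "n - k = Suc m" "int n = int m + int k + 1"
    using Suc.prems by (auto simp: m_def)
  define w where "w = q powi (1 - int n + int k)"
  have w: "w * q ^ m = 1"
    using assms(1) by (simp add: w_def m power_int_minus field_simps)
  have wk: "q powi (1 - int n) * q ^ k = w"
    using assms(1) by (simp add: w_def power_int_add)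
  have step: "(1 - w / y) * y = - w * (1 - y * q ^ m)"
    using w assms(2) by (simp add: field_simps)
  let ?P = "qpoch (q powi (1 - int n) / y) q k"
  have "qpoch (q powi (1 - int n) / y) q (Suc k) * qpoch y q (n - Suc k) * y ^ Suc k
      = ?P * qpoch y q m * y ^ k * ((1 - w / y) * y)"
    by (simp add: qpoch_Suc m_def wk flip: wk)
  also have "\<dots> = (?P * qpoch y q (n - k) * y ^ k) * (- w)"
    by (simp only: step m qpoch_Suc) (simp add: algebra_simps)
  also have "\<dots> = qpoch y q n * (\<Prod>i<Suc k. - (q powi (1 - int n + int i)))"
    using Suc by (simp add: w_def)
  finally show ?case .
qed simp

section \<open>A q-analogue of Clausen's formula\<close>

text \<open>The condition \<open>a * b = e * s\<close> is what makes the mixed product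
  \<open>F 1 * F 4\<close> cancel between the two residuals combined below. The equation left for
  f(z) f(s z) has coefficients of degree one in z, hence a two-term recurrence for
  \<open>G\<close>.\<close>

lemma convolution_recurrence:
  fixes U :: "nat \<Rightarrow> complex" and a b e s :: complex
  defines "G \<equiv> \<lambda>m. \<Sum>i\<le>m. U i * U (m - i) * s ^ i"
  assumes ab: "a * b = e * s"
    and rec: "\<And>k. k < n \<Longrightarrow> U (Suc k) * (1 - (s\<^sup>2) ^ Suc k) * (1 - e * (s\<^sup>2) ^ Suc k)
              = U k * (1 - a * (s\<^sup>2) ^ k) * (1 - b * (s\<^sup>2) ^ k)"
    and m: "m < n"
  shows "G (Suc m) * (1 - e * (s\<^sup>2) ^ Suc m) * (1 - s ^ Suc m) * (1 - e * s ^ Suc m)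
    = G m * (1 - a * b * (s\<^sup>2) ^ m) * (1 - a * s ^ m) * (1 - b * s ^ m)"
proof -
  \<comment> \<open>\<open>F j\<close> is \<open>f(s\<^sup>j z)\<close> and \<open>R j\<close> is the residual of the \<open>s\<^sup>2\<close>-difference equation of \<open>f\<close> at \<open>s\<^sup>j z\<close>;
    since \<open>rec\<close> holds only below \<open>n\<close>, the residual vanishes only up to degree \<open>n\<close>.\<close>
  define F where "F j = Abs_fps (\<lambda>k. U k * s ^ (j * k))" for j
  define R where "R j = fps_const e * F (j + 4) - fps_const (e * s ^ Suc j) * (fps_X * F (j + 4))
      - fps_const (1 + e) * F (j + 2) + fps_const ((a + b) * s ^ j) * (fps_X * F (j + 2))
      + F j - fps_const (s ^ j) * (fps_X * F j)" for j
  define H where "H j = F (Suc j) * F j" for j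
  have R0: "fps_nth (R j) k = 0" if "k \<le> n" for j k
  proof (cases k)
    case 0
    then show ?thesis by (simp add: R_def F_def algebra_simps)
  next
    case (Suc i)
    let ?y = "s ^ i" and ?z = "s ^ (j * i)"
    have "U (Suc i) * (1 - s\<^sup>2 * ?y\<^sup>2) * (1 - e * s\<^sup>2 * ?y\<^sup>2)
        = U i * (1 - a * ?y\<^sup>2) * (1 - b * ?y\<^sup>2)"
      using rec[of i] Suc that by (simp add: power_mult_distrib power_even_eq mult_ac flip: power_mult)
    then have "U (Suc i) * (1 - s\<^sup>2 * ?y\<^sup>2) * (1 - e * s\<^sup>2 * ?y\<^sup>2)
        = U i * (1 - (a + b) * ?y\<^sup>2 + e * s * ?y ^ 4)"
      unfolding ab[symmetric] by (simp add: algebra_simps power2_eq_square power4_eq_xxxx)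
    then have "s ^ j * ?z * (U (Suc i) * (1 - s\<^sup>2 * ?y\<^sup>2) * (1 - e * s\<^sup>2 * ?y\<^sup>2)
        - U i * (1 - (a + b) * ?y\<^sup>2 + e * s * ?y ^ 4)) = 0"
      by simp
    moreover have p: "s ^ (4 * i) = ?y ^ 4" "s ^ (2 * i) = ?y\<^sup>2"
      by (simp_all add: mult.commute flip: power_mult)
    moreover have "s ^ ((j + 4) * i) = ?z * ?y ^ 4" "s ^ ((j + 2) * i) = ?z * ?y\<^sup>2"
      "s ^ ((j + 4) * Suc i) = s ^ j * s ^ 4 * ?z * ?y ^ 4"
      "s ^ ((j + 2) * Suc i) = s ^ j * s\<^sup>2 * ?z * ?y\<^sup>2" "s ^ (j * Suc i) = s ^ j * ?z"
      by (simp_all only: add_mult_distrib mult_Suc_right power_add p) (simp_all only: mult_ac)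
    ultimately show ?thesis
      by (simp only: R_def F_def Suc fps_add_nth fps_sub_nth fps_mult_left_const_nth
          fps_X_mult_nth fps_nth_Abs_fps) (simp add: algebra_simps eval_nat_numeral)
  qed
  \<comment> \<open>In this combination of residuals only the products \<open>f(s\<^sup>j z) f(s\<^sup>j\<^sup>+\<^sup>1 z)\<close> survive, which makes it
    a difference equation for \<open>f(z) f(s z)\<close>.\<close>
  have "fps_const e * (F 4 * R 1) - F 1 * R 0
      = fps_const (e\<^sup>2) * H 4 - fps_const (e\<^sup>2 * s\<^sup>2) * (fps_X * H 4)
        - fps_const (e * (1 + e)) * H 3 + fps_const (e * (a + b) * s) * (fps_X * H 3)
        + fps_const (1 + e) * H 1 - fps_const (a + b) * (fps_X * H 1)
        - H 0 + fps_X * H 0"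
    by (simp add: R_def H_def algebra_simps eval_nat_numeral
        flip: fps_const_mult fps_const_add)
  moreover have "fps_nth (fps_const e * (F 4 * R 1) - F 1 * R 0) (Suc m) = 0"
    using m by (simp add: fps_mult_nth R0)
  \<comment> \<open>\<open>H j\<close> is f(z) f(s z) with z replaced by s^j z.\<close>
  moreover have "fps_nth (H j) k = s ^ (j * k) * G k" for j k
  proof -
    have "s ^ (j * i + i) * s ^ (j * (k - i)) = s ^ (j * k) * s ^ i" if "i \<le> k" for i
      using that by (simp add: diff_mult_distrib2 add.commute flip: power_add)
    then have "U i * s ^ (Suc j * i) * (U (k - i) * s ^ (j * (k - i))) = s ^ (j * k) * (U i * U (k - i) * s ^ i)"
      if "i \<le> k" for i
      using that by (simp add: add.commute mult.assoc mult.left_commute)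
    then show ?thesis
      unfolding H_def F_def G_def fps_mult_nth fps_nth_Abs_fps sum_distrib_left atMost_atLeast0
      by (intro sum.cong) auto
  qed
  \<comment> \<open>With t = s^(m+1) and y = s^m, the coefficient of \<open>G (Suc m)\<close>
    factors as -(1 - e t^2)(1 - t)(1 - e t), and that of \<open>G m\<close> as (1 - a b y^2)(1 - a
    y)(1 - b y).\<close>
  ultimately have "e\<^sup>2 * s ^ (4 * Suc m) * G (Suc m) - e\<^sup>2 * s\<^sup>2 * s ^ (4 * m) * G m
        - e * (1 + e) * s ^ (3 * Suc m) * G (Suc m) + e * (a + b) * s * s ^ (3 * m) * G m
        + (1 + e) * s ^ Suc m * G (Suc m) - (a + b) * s ^ m * G m - G (Suc m) + G m = 0"
    by (simp add: mult.assoc)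
  moreover have "s ^ (4 * k) = (s ^ k) ^ 4" "s ^ (3 * k) = (s ^ k) ^ 3" "(s\<^sup>2) ^ k = (s ^ k)\<^sup>2" for k
    by (simp_all add: mult.commute flip: power_mult)
  moreover have "G m * (1 - a * b * (s ^ m)\<^sup>2) * (1 - a * s ^ m) * (1 - b * s ^ m)
    = G m * (1 - (a * b) * (s ^ m)\<^sup>2) * (1 - (a + b) * s ^ m + (a * b) * (s ^ m)\<^sup>2)"
    by (simp add: algebra_simps power2_eq_square)
  ultimately show ?thesis
    unfolding ab by (simp only:) (simp add: algebra_simps eval_nat_numeral)
qed

text \<open>The recurrence is iterated from G_0 = 1. Since e s = a b, its factor 1 - e s^(m+1) is 1
  - a b s^m and builds up (a b; s)_m. Denominators are cleared because that symbol may vanish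
  here.\<close>

lemma q_Clausen_coefficient:
  fixes a b e s :: complex
  defines "U \<equiv> \<lambda>k. qpoch a (s\<^sup>2) k * qpoch b (s\<^sup>2) k / (qpoch (s\<^sup>2) (s\<^sup>2) k * qpoch (e * s\<^sup>2) (s\<^sup>2) k)"
  assumes ab: "a * b = e * s"
    and nz: "qpoch (s\<^sup>2) (s\<^sup>2) n \<noteq> 0" "qpoch (e * s\<^sup>2) (s\<^sup>2) n \<noteq> 0"
  shows "qpoch (a * b) s n * qpoch s s n * qpoch (e * s\<^sup>2) (s\<^sup>2) n * (\<Sum>i\<le>n. U i * U (n - i) * s ^ i)
    = qpoch (a * b) (s\<^sup>2) n * qpoch a s n * qpoch b s n"
proof -
  define G where "G m = (\<Sum>i\<le>m. U i * U (m - i) * s ^ i)" for m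
  have rec: "U (Suc k) * (1 - (s\<^sup>2) ^ Suc k) * (1 - e * (s\<^sup>2) ^ Suc k)
              = U k * (1 - a * (s\<^sup>2) ^ k) * (1 - b * (s\<^sup>2) ^ k)" if "k < n" for k
    using qpoch_nonzero_le[OF nz(1), of "Suc k"] qpoch_nonzero_le[OF nz(2), of "Suc k"] that
    by (simp add: U_def qpoch_Suc mult.assoc divide_simps)
  have "qpoch (a * b) s m * qpoch s s m * qpoch (e * s\<^sup>2) (s\<^sup>2) m * G m
    = qpoch (a * b) (s\<^sup>2) m * qpoch a s m * qpoch b s m" if "m \<le> n" for m
    using that
  proof (induction m)
    case 0
    then show ?case by (simp add: G_def U_def)
  next
    case (Suc m)
    have step: "G (Suc m) * (1 - e * (s\<^sup>2) ^ Suc m) * (1 - s ^ Suc m) * (1 - e * s ^ Suc m)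
      = G m * (1 - a * b * (s\<^sup>2) ^ m) * (1 - a * s ^ m) * (1 - b * s ^ m)"
      unfolding G_def using Suc.prems by (intro convolution_recurrence[OF ab rec]) auto
    let ?Q = "qpoch (a * b) s m * qpoch s s m * qpoch (e * s\<^sup>2) (s\<^sup>2) m"
    have "qpoch (a * b) s (Suc m) * qpoch s s (Suc m) * qpoch (e * s\<^sup>2) (s\<^sup>2) (Suc m) * G (Suc m)
      = ?Q * (G (Suc m) * (1 - e * (s\<^sup>2) ^ Suc m) * (1 - s ^ Suc m) * (1 - e * s ^ Suc m))"
      by (simp add: qpoch_Suc ab mult_ac)
    also have "\<dots> = (?Q * G m) * ((1 - a * b * (s\<^sup>2) ^ m) * (1 - a * s ^ m) * (1 - b * s ^ m))"
      unfolding step by (simp add: mult_ac)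
    also have "\<dots> = qpoch (a * b) (s\<^sup>2) (Suc m) * qpoch a s (Suc m) * qpoch b s (Suc m)"
      using Suc by (simp add: qpoch_Suc mult_ac)
    finally show ?case .
  qed
  then show ?thesis by (simp add: G_def)
qed

section \<open>Symmetrizing and summing the series\<close>

text \<open>Reversal is applied with y = q and y = e above, y = a and y = \<beta> below. The
  products \<open>W\<close> cancel, and the powers left over are q^k (a \<beta>)^k / (q e)^k =
  s^(-k), as e = a \<beta> s.\<close>

lemma summand_reversed:
  fixes a b s :: complex
  defines "q \<equiv> s\<^sup>2"
  defines "\<beta> \<equiv> b / q" and "e \<equiv> a * b / s"
  assumes "s \<noteq> 0" "a \<noteq> 0" "b \<noteq> 0" "k \<le> n"
    and nz: "qpoch q q n \<noteq> 0" "qpoch a q n \<noteq> 0" "qpoch \<beta> q n \<noteq> 0" "qpoch e q n \<noteq> 0"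
  shows "qpoch (q powi (- int n)) q k * qpoch a q k * qpoch b q k * qpoch (s powi (3 - 2 * int n) / (a * b)) q k
      / (qpoch q q k * qpoch (q powi (1 - int n) / a) q k * qpoch (q powi (2 - int n) / b) q k * qpoch (s * a * b) q k) * q ^ k
    = qpoch q q n * qpoch e q n / (qpoch a q n * qpoch \<beta> q n)
      * (qpoch a q k * qpoch a q (n - k) * qpoch b q k * qpoch \<beta> q (n - k)
         / (qpoch q q k * qpoch q q (n - k) * qpoch (e * q) q k * qpoch e q (n - k))) / s ^ k"
proof -
  define W where "W = (\<Prod>i<k. - (q powi (1 - int n + int i)))"
  have nz0: "q \<noteq> 0" "\<beta> \<noteq> 0" "e \<noteq> 0" "W \<noteq> 0"
    using assms(4-6) by (simp_all add: q_def \<beta>_def e_def W_def)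
  have q2: "q powi k = s powi (2 * k)" for k
    by (simp add: q_def power_int_mult)
  have args: "q powi (- int n) = q powi (1 - int n) / q" "q powi (2 - int n) / b = q powi (1 - int n) / \<beta>"
    "s powi (3 - 2 * int n) / (a * b) = q powi (1 - int n) / e" "s * a * b = e * q"
    using assms(4-6) nz0 by (simp_all add: \<beta>_def e_def power_int_diff power_int_minus
        divide_simps) (simp_all add: q_def power_int_mult power2_eq_square power3_eq_cube)
  have rev: "qpoch (q powi (1 - int n) / y) q k = qpoch y q n * W / (qpoch y q (n - k) * y ^ k)"
    if "y \<noteq> 0" "qpoch y q n \<noteq> 0" for y
    using qpoch_reverse[OF nz0(1) that(1) assms(7)] that qpoch_nonzero_le[OF that(2), of "n - k"]
    by (simp add: W_def field_simps)
  have "a * \<beta> * s = e"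
    using assms(4) by (simp add: \<beta>_def e_def q_def power2_eq_square)
  then have pw: "e ^ k = a ^ k * \<beta> ^ k * s ^ k"
    by (metis power_mult_distrib)
  have nz': "qpoch q q (n - k) \<noteq> 0" "qpoch a q (n - k) \<noteq> 0" "qpoch \<beta> q (n - k) \<noteq> 0" "qpoch e q (n - k) \<noteq> 0"
    using nz qpoch_nonzero_le[of _ q n "n - k"] by auto
  show ?thesis
    unfolding args rev[OF nz0(1) nz(1)] rev[OF assms(5) nz(2)] rev[OF nz0(2) nz(3)] rev[OF nz0(3) nz(4)] pw
    using nz nz' nz0 assms(4,5) by (simp add: divide_simps)
qed

text \<open>The two terms in the final bracket are the contributions of the two convolutions:
  \<open>GV\<close> carries the weight x - 1/(\<beta> q^n), and \<open>GU\<close> the weight e -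
  x.\<close>

lemma reversed_sum:
  fixes a \<beta> s x :: complex and n :: nat
  defines "q \<equiv> s\<^sup>2"
  defines "b \<equiv> \<beta> * q" and "e \<equiv> a * \<beta> * s"
  defines "T \<equiv> \<lambda>k. qpoch a q k * qpoch a q (n - k) * qpoch b q k * qpoch \<beta> q (n - k)
         / (qpoch q q k * qpoch q q (n - k) * qpoch (e * q) q k * qpoch e q (n - k)) / s ^ k"
  assumes "s \<noteq> 0" "a \<noteq> 0" "\<beta> \<noteq> 0"
    and nz: "qpoch q q n \<noteq> 0" "qpoch e q n \<noteq> 0" "qpoch (e * q) q n \<noteq> 0" "qpoch (a * \<beta>) s n \<noteq> 0"
      "1 - e \<noteq> 0" "1 - \<beta> \<noteq> 0" "1 - \<beta> * s \<noteq> 0" "1 - a * \<beta> \<noteq> 0" "1 - a * \<beta> * s ^ n \<noteq> 0"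
      "1 - e * q ^ n \<noteq> 0" "1 - e * \<beta> * q ^ n \<noteq> 0"
  shows "qpoch q q n * qpoch e q n * (\<Sum>k\<le>n. T k * (1 - x * q ^ k))
    = qpoch (a * \<beta>) q n * (qpoch a s n * qpoch \<beta> s n * qpoch (- s) s n / qpoch (a * \<beta>) s n)
      * ((1 - e) * (1 - \<beta> * s ^ n) / (1 - e * \<beta> * q ^ n))
      * ((1 / s ^ n - x * \<beta> * s ^ n) / (1 - \<beta>)
         - (1 - \<beta> * s * s ^ n) * (x - e) * (1 - a * \<beta> * q ^ n)
           / ((1 - \<beta> * s) * (1 - e * q ^ n) * (1 - a * \<beta> * s ^ n)))"
proof -
  define V where "V k = qpoch a q k * qpoch \<beta> q k / (qpoch q q k * qpoch e q k)" for k
  define U where "U k = qpoch a q k * qpoch b q k / (qpoch q q k * qpoch (e * q) q k)" for k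
  define GV where "GV = (\<Sum>i\<le>n. V i * V (n - i) * s ^ i)"
  define GU where "GU = (\<Sum>i\<le>n. U i * U (n - i) * s ^ i)"
  define Y where "Y = s ^ n"
  have [simp]: "q \<noteq> 0" "Y \<noteq> 0" using assms(5) by (simp_all add: q_def Y_def)
  have qn: "q ^ n = Y\<^sup>2" by (simp add: q_def Y_def power_mult [symmetric] mult.commute)
  have rev: "(\<Sum>i\<le>n. f i * f (n - i) * s ^ (n - i)) = (\<Sum>i\<le>n. f i * f (n - i) * s ^ i)" for f :: "nat \<Rightarrow> complex"
    by (intro sum.reindex_bij_witness[of _ "\<lambda>i. n - i" "\<lambda>i. n - i"]) auto
  have qs: "q ^ k = s ^ k * s ^ k" for k
    by (simp add: q_def power2_eq_square power_mult_distrib)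
  have Ys: "Y = s ^ k * s ^ (n - k)" if "k \<le> n" for k
    using that by (simp add: Y_def flip: power_add)

  \<comment> \<open>The factor 1 - e q^k changes (e q)_k into (e)_k, while (b)_k = (\<beta> q)_k
    becomes (\<beta>)_k at the cost of 1 - \<beta> q^k. Divided by s^k, this last factor splits into
    one power of s for each orientation of the convolution.\<close>
  have TV: "T k * (1 - e * q ^ k) = (1 - e) / (1 - \<beta>) * (V k * V (n - k) * s ^ (n - k) / Y - \<beta> * (V k * V (n - k) * s ^ k))"
    if "k \<le> n" for k
  proof -
    have b: "qpoch b q k = qpoch \<beta> q k * (1 - \<beta> * q ^ k) / (1 - \<beta>)"
      using qpoch_shift[of \<beta> q k] nz(6) by (simp add: b_def field_simps)
    have e: "(1 - e * q ^ k) / qpoch (e * q) q k = (1 - e) / qpoch e q k"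
      using qpoch_shift[of e q k] qpoch_nonzero_le[OF nz(2) that] qpoch_nonzero_le[OF nz(3) that]
      by (simp add: frac_eq_eq mult.commute)
    define A where "A = qpoch a q k * qpoch a q (n - k) * qpoch \<beta> q (n - k) / (qpoch q q k * qpoch q q (n - k) * qpoch e q (n - k))"
    have "T k * (1 - e * q ^ k) = A * qpoch b q k * ((1 - e * q ^ k) / qpoch (e * q) q k) / s ^ k"
      by (simp add: T_def A_def mult_ac)
    also have "\<dots> = (1 - e) / (1 - \<beta>) * (V k * V (n - k)) * ((1 - \<beta> * q ^ k) / s ^ k)"
      unfolding b e by (simp add: A_def V_def mult_ac)
    also have "(1 - \<beta> * q ^ k) / s ^ k = s ^ (n - k) / Y - \<beta> * s ^ k"
      using assms(5) by (simp add: Ys[OF that] qs field_simps)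
    also have "c * (V k * V (n - k)) * (s ^ (n - k) / Y - \<beta> * s ^ k)
      = c * (V k * V (n - k) * s ^ (n - k) / Y - \<beta> * (V k * V (n - k) * s ^ k))" for c
      by (simp add: algebra_simps)
    finally show ?thesis .
  qed
  \<comment> \<open>Here the factor is -(q^(k-n)/\<beta>)(1 - \<beta> q^(n-k)), which changes
    (\<beta>)_(n-k) into (b)_(n-k). Changing (e)_(n-k) into (e q)_(n-k) leaves 1 - e q^(n-k), which
    again splits into two powers of s.\<close>
  have TU: "T k * (1 - q ^ k / (\<beta> * q ^ n))
      = - ((1 - \<beta>) / ((1 - e) * \<beta> * Y\<^sup>2)) * (U k * U (n - k) * s ^ k - e * Y * (U k * U (n - k) * s ^ (n - k)))"
    if "k \<le> n" for k
  proof -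
    have b: "qpoch \<beta> q (n - k) * (1 - \<beta> * q ^ (n - k)) = (1 - \<beta>) * qpoch b q (n - k)"
      using qpoch_shift[of \<beta> q "n - k"] by (simp add: b_def)
    have e: "1 / qpoch e q (n - k) = (1 - e * q ^ (n - k)) / ((1 - e) * qpoch (e * q) q (n - k))"
      using qpoch_shift[of e q "n - k"] nz(5) qpoch_nonzero_le[OF nz(2), of "n - k"]
        qpoch_nonzero_le[OF nz(3), of "n - k"] by (simp add: field_simps)
    define A where "A = qpoch a q k * qpoch a q (n - k) * qpoch b q k / (qpoch q q k * qpoch q q (n - k) * qpoch (e * q) q k)"
    have "1 - q ^ k / (\<beta> * q ^ n) = - ((1 - \<beta> * q ^ (n - k)) * (s ^ k * s ^ k) / (\<beta> * Y\<^sup>2))"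
      using assms(5,7) by (simp add: qn) (simp add: Ys[OF that] qs field_simps power2_eq_square)
    then have "T k * (1 - q ^ k / (\<beta> * q ^ n))
      = - (A * (qpoch \<beta> q (n - k) * (1 - \<beta> * q ^ (n - k))) * (1 / qpoch e q (n - k)) * s ^ k / (\<beta> * Y\<^sup>2))"
      using assms(5) by (simp add: T_def A_def mult_ac)
    also have "\<dots> = - (A * ((1 - \<beta>) * qpoch b q (n - k)) * ((1 - e * q ^ (n - k)) / ((1 - e) * qpoch (e * q) q (n - k))) * s ^ k / (\<beta> * Y\<^sup>2))"
      unfolding b e ..
    also have "\<dots> = - ((1 - \<beta>) / ((1 - e) * \<beta> * Y\<^sup>2)) * (U k * U (n - k)) * ((1 - e * q ^ (n - k)) * s ^ k)"
      by (simp add: A_def U_def mult_ac)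
    also have "(1 - e * q ^ (n - k)) * s ^ k = s ^ k - e * Y * s ^ (n - k)"
      by (simp add: Ys[OF that] qs algebra_simps)
    also have "c * (U k * U (n - k)) * (s ^ k - e * Y * s ^ (n - k))
      = c * (U k * U (n - k) * s ^ k - e * Y * (U k * U (n - k) * s ^ (n - k)))" for c
      by (simp add: algebra_simps)
    finally show ?thesis .
  qed
  have SV: "(\<Sum>k\<le>n. T k * (1 - e * q ^ k)) = (1 - e) / (1 - \<beta>) * ((1 / Y - \<beta>) * GV)"
  proof -
    have "(\<Sum>k\<le>n. T k * (1 - e * q ^ k))
      = (\<Sum>k\<le>n. (1 - e) / (1 - \<beta>) * (V k * V (n - k) * s ^ (n - k) / Y - \<beta> * (V k * V (n - k) * s ^ k)))"
      by (intro sum.cong) (auto simp only: TV atMost_iff)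
    also have "\<dots> = (1 - e) / (1 - \<beta>) * ((\<Sum>k\<le>n. V k * V (n - k) * s ^ (n - k)) / Y - \<beta> * GV)"
      by (simp only: sum_distrib_left sum_divide_distrib GV_def flip: sum_subtractf)
    finally show ?thesis by (simp add: rev[of V] GV_def left_diff_distrib)
  qed
  have SU: "(\<Sum>k\<le>n. T k * (1 - q ^ k / (\<beta> * q ^ n)))
      = - ((1 - \<beta>) / ((1 - e) * \<beta> * Y\<^sup>2)) * ((1 - e * Y) * GU)"
  proof -
    have "(\<Sum>k\<le>n. T k * (1 - q ^ k / (\<beta> * q ^ n)))
      = (\<Sum>k\<le>n. - ((1 - \<beta>) / ((1 - e) * \<beta> * Y\<^sup>2))
          * (U k * U (n - k) * s ^ k - e * Y * (U k * U (n - k) * s ^ (n - k))))"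
      by (intro sum.cong) (auto simp only: TU atMost_iff)
    also have "\<dots> = - ((1 - \<beta>) / ((1 - e) * \<beta> * Y\<^sup>2))
        * (GU - e * Y * (\<Sum>k\<le>n. U k * U (n - k) * s ^ (n - k)))"
      by (simp only: sum_distrib_left GU_def flip: sum_subtractf)
    finally show ?thesis by (simp add: rev[of U] GU_def left_diff_distrib)
  qed

  define P where "P = qpoch (a * \<beta>) q n * (qpoch a s n * qpoch \<beta> s n * qpoch (- s) s n / qpoch (a * \<beta>) s n)"
  have qq: "qpoch q q n = qpoch s s n * qpoch (- s) s n" unfolding q_def by (rule qpoch_sq)
  have ss: "qpoch s s n \<noteq> 0" using nz(1) qq by auto
  \<comment> \<open>The lower parameter in \<open>V\<close> is e rather than e q, so the closed form
    is used with e / q in place of e.\<close>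
  have "a * \<beta> = e / q * s" using assms(5) by (simp add: e_def q_def power2_eq_square)
  from q_Clausen_coefficient[OF this, of n]
  have "qpoch (a * \<beta>) s n * qpoch s s n * qpoch e q n * GV = qpoch (a * \<beta>) q n * qpoch a s n * qpoch \<beta> s n"
    using nz(1,2) assms(5) by (simp add: GV_def V_def flip: q_def)
  then have GV: "qpoch q q n * qpoch e q n * GV = P"
    using nz(4) ss by (simp add: qq P_def field_simps)
  have "a * b = e * s" by (simp add: e_def b_def q_def power2_eq_square)
  from q_Clausen_coefficient[OF this, of n]
  have U0: "qpoch (a * b) s n * qpoch s s n * qpoch (e * q) q n * GU = qpoch (a * b) q n * qpoch a s n * qpoch b s n"
    using nz(1,3) by (simp add: GU_def U_def flip: q_def)
  have U1: "qpoch (a * b) s n = qpoch (a * \<beta>) s n * (1 - a * \<beta> * Y) * (1 - e * Y) / ((1 - a * \<beta>) * (1 - e))"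
    using qpoch_shift2[of "a * \<beta>" s n] nz(5,8)
    by (simp add: b_def e_def q_def Y_def mult.assoc)
  have U2: "qpoch (e * q) q n = qpoch e q n * (1 - e * Y\<^sup>2) / (1 - e)"
    using qpoch_shift[of e q n] nz(5) by (simp add: field_simps qn)
  have U3: "qpoch (a * b) q n = qpoch (a * \<beta>) q n * (1 - a * \<beta> * Y\<^sup>2) / (1 - a * \<beta>)"
    using qpoch_shift[of "a * \<beta>" q n] nz(8) by (simp add: field_simps b_def qn)
  have U4: "qpoch b s n = qpoch \<beta> s n * (1 - \<beta> * Y) * (1 - \<beta> * s * Y) / ((1 - \<beta>) * (1 - \<beta> * s))"
    using qpoch_shift2[of \<beta> s n] nz(6,7)
    by (simp add: b_def q_def Y_def)
  \<comment> \<open>The rational identity is isolated in free variables. Here \<open>u\<close>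
    stands for 1 - e and \<open>d2\<close> for 1 - e Y; the latter may vanish, so (1 - e Y)
    \<open>GU\<close> is evaluated as one product, the form in which \<open>SU\<close> contains
    it.\<close>
  have "S * M * E * (d2 * G) = Q * (as * B * M / A) * (u\<^sup>2 * d5 * d6 * d7 / (d1 * d4 * d8 * d9))"
    if "A * d1 * d2 / (d3 * u) * S * (E * d4 / u) * G = (Q * d5 / d3) * as * (B * d6 * d7 / (d8 * d9))"
      "A \<noteq> 0" "u \<noteq> 0" "d1 \<noteq> 0" "d3 \<noteq> 0" "d4 \<noteq> 0" "d8 \<noteq> 0" "d9 \<noteq> 0"
    for S M E G Q as B A u d1 d2 d3 d4 d5 d6 d7 d8 d9 :: complex
    using that by (simp add: field_simps power2_eq_square)
  from this[OF U0[unfolded U1 U2 U3 U4]] have GU: "qpoch q q n * qpoch e q n * ((1 - e * Y) * GU)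
    = P * ((1 - e)\<^sup>2 * (1 - a * \<beta> * Y\<^sup>2) * (1 - \<beta> * Y) * (1 - \<beta> * s * Y)
        / ((1 - a * \<beta> * Y) * (1 - e * Y\<^sup>2) * (1 - \<beta>) * (1 - \<beta> * s)))"
    unfolding qq P_def by (rule) (use nz in \<open>simp_all add: qn flip: Y_def\<close>)

  \<comment> \<open>The second symmetrizing factor is 1 - c q^k, so 1 - x q^k is interpolated
    between 1 - e q^k and 1 - c q^k; e and c differ because 1 - e \<beta> q^n is nonzero.\<close>
  define c where "c = 1 / (\<beta> * Y\<^sup>2)"
  have ec: "e - c \<noteq> 0"
    using nz(11) assms(7) by (simp add: c_def qn field_simps)
  have "T k * (1 - x * q ^ k) = ((x - c) * (T k * (1 - e * q ^ k)) + (e - x) * (T k * (1 - q ^ k / (\<beta> * q ^ n)))) / (e - c)" for k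
  proof -
    have "q ^ k / (\<beta> * q ^ n) = c * q ^ k" by (simp add: c_def qn)
    then show ?thesis using ec by (simp add: field_simps)
  qed
  then have "qpoch q q n * qpoch e q n * (\<Sum>k\<le>n. T k * (1 - x * q ^ k))
    = ((x - c) * ((1 - e) / (1 - \<beta>) * (1 / Y - \<beta>)) * (qpoch q q n * qpoch e q n * GV)
       - (e - x) * ((1 - \<beta>) / ((1 - e) * \<beta> * Y\<^sup>2)) * (qpoch q q n * qpoch e q n * ((1 - e * Y) * GU))) / (e - c)"
    by (simp add: sum.distrib SV SU flip: sum_distrib_left sum_divide_distrib) (simp add: algebra_simps)
  also have "\<dots> = P * ((1 - e) * (1 - \<beta> * Y) / (1 - e * \<beta> * Y\<^sup>2)
      * ((1 / Y - x * \<beta> * Y) / (1 - \<beta>)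
         - (1 - \<beta> * s * Y) * (x - e) * (1 - a * \<beta> * Y\<^sup>2)
           / ((1 - \<beta> * s) * (1 - e * Y\<^sup>2) * (1 - a * \<beta> * Y))))"
  proof -
    have "((x - c) * ((1 - e) / (1 - \<beta>) * (1 / Y - \<beta>)) * P
       - (e - x) * ((1 - \<beta>) / ((1 - e) * \<beta> * Y\<^sup>2)) * (P * ((1 - e)\<^sup>2 * p * (1 - \<beta> * Y) * t / (u * v * (1 - \<beta>) * w)))) / (e - c)
      = P * ((1 - e) * (1 - \<beta> * Y) / (1 - e * \<beta> * Y\<^sup>2) * ((1 / Y - x * \<beta> * Y) / (1 - \<beta>) - t * (x - e) * p / (w * v * u)))"
      for p t u v w
    proof -
      define h where "h = t * p / (w * v * u)"
      have e1: "(x - c) * ((1 - e) / (1 - \<beta>) * (1 / Y - \<beta>))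
        = (1 - e) * (1 - \<beta> * Y) / (\<beta> * Y\<^sup>2) * - ((1 / Y - x * \<beta> * Y) / (1 - \<beta>))"
        using assms(7) nz(6) by (simp add: c_def field_simps power2_eq_square)
      have e2: "(e - x) * ((1 - \<beta>) / ((1 - e) * \<beta> * Y\<^sup>2)) * (P * ((1 - e)\<^sup>2 * p * (1 - \<beta> * Y) * t / (u * v * (1 - \<beta>) * w)))
        = P * ((1 - e) * (1 - \<beta> * Y) / (\<beta> * Y\<^sup>2) * ((e - x) * h))"
        using nz(5,6) by (simp add: h_def power2_eq_square mult_ac)
      have e3: "e - c = - (1 - e * \<beta> * Y\<^sup>2) / (\<beta> * Y\<^sup>2)"
        using assms(7) by (simp add: c_def field_simps)
      have e4: "t * (x - e) * p / (w * v * u) = (x - e) * h"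
        by (simp add: h_def mult_ac)
      define D where "D = (1 / Y - x * \<beta> * Y) / (1 - \<beta>)"
      define g where "g = \<beta> * Y\<^sup>2"
      have "g \<noteq> 0" using assms(7) by (simp add: g_def)
      have "1 - e * g \<noteq> 0" using nz(11) by (simp add: qn g_def mult.assoc)
      then show ?thesis
        using \<open>g \<noteq> 0\<close> unfolding e1 e2 e3 e4 D_def[symmetric] mult.assoc[of e \<beta>] g_def[symmetric]
        by (simp add: divide_simps) (simp add: algebra_simps)
    qed
    then show ?thesis unfolding GV GU .
  qed
  finally show ?thesis
    by (simp add: P_def qn mult.assoc flip: Y_def)
qed

section \<open>From the hypergeometric series to the finite symmetric sum\<close>

theorem theorem5:
  fixes q s a b x :: complex and n :: nat
  assumes "q \<noteq> 0" and "s ^ 2 = q" and "a \<noteq> 0" and "b \<noteq> 0"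
    and "\<And>k. k \<le> n \<Longrightarrow>
      qhyp_denom [x, q powi (1 - int n) / a, q powi (2 - int n) / b, s * a * b] q k \<noteq> 0"
    and "qpoch a q n \<noteq> 0" and "qpoch (b / q) q n \<noteq> 0" and "qpoch (a * b / q) s n \<noteq> 0"
    and "1 - x \<noteq> 0" and "s ^ 3 - a * b ^ 2 * q ^ n \<noteq> 0"
    and "q - b \<noteq> 0" and "s - b \<noteq> 0" and "s - a * b * q ^ n \<noteq> 0" and "q - a * b * s ^ n \<noteq> 0"
  shows "qhyp [q powi (- int n), q * x, a, b, s powi (3 - 2 * int n) / (a * b)]
              [x, q powi (1 - int n) / a, q powi (2 - int n) / b, s * a * b] q q
    = qpoch (a * b / q) q n / (qpoch a q n * qpoch (b / q) q n)
      * (qpoch a s n * qpoch (b / q) s n * qpoch (- s) s n / qpoch (a * b / q) s n)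
      * ((s - a * b) * (q - b * s ^ n) / ((1 - x) * (s ^ 3 - a * b ^ 2 * q ^ n)))
      * ((s powi (2 - int n) - x * b * s ^ n) / (q - b)
         - (s - b * s ^ n) * (s * x - a * b) * (q - a * b * q ^ n)
           / ((s - b) * (s - a * b * q ^ n) * (q - a * b * s ^ n)))"
proof -
  define \<beta> where "\<beta> = b / q"
  define e where "e = a * b / s"
  define t where "t k = qpoch (q powi (- int n)) q k * qpoch a q k * qpoch b q k * qpoch (s powi (3 - 2 * int n) / (a * b)) q k
      / (qpoch q q k * qpoch (q powi (1 - int n) / a) q k * qpoch (q powi (2 - int n) / b) q k * qpoch (s * a * b) q k) * q ^ k" for k
  have q: "q = s\<^sup>2" and s: "s \<noteq> 0" using assms(1,2) by auto
  have \<beta>: "\<beta> \<noteq> 0" "b = \<beta> * s\<^sup>2" and e: "a * \<beta> * s = e" "s * a * b = e * q"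
    and ab: "a * b / q = a * \<beta>" "s - a * b = s * (1 - e)"
    using assms(1,4) s by (simp_all add: \<beta>_def e_def q power2_eq_square field_simps)
  have denom: "qpoch q q k \<noteq> 0" "qpoch x q k \<noteq> 0" "qpoch (e * q) q k \<noteq> 0" if "k \<le> n" for k
    using assms(5)[OF that] by (auto simp: qhyp_denom_def e(2))
  have factored: "s - b * s ^ n = s * (1 - \<beta> * s * s ^ n)" "s * x - a * b = s * (x - e)"
    "q - a * b * q ^ n = q * (1 - a * \<beta> * q ^ n)" "s - b = s * (1 - \<beta> * s)"
    "s - a * b * q ^ n = s * (1 - e * q ^ n)" "q - a * b * s ^ n = q * (1 - a * \<beta> * s ^ n)"
    "q - b * s ^ n = q * (1 - \<beta> * s ^ n)" "q - b = q * (1 - \<beta>)"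
    "s ^ 3 - a * b ^ 2 * q ^ n = s * q * (1 - e * \<beta> * q ^ n)"
    using s by (simp_all add: \<beta>_def e_def q power2_eq_square power3_eq_cube right_diff_distrib)
  have a\<beta>n: "1 - a * \<beta> * s ^ n \<noteq> 0"
    using assms(14) by (auto simp: factored)
  have a\<beta>: "1 - a * \<beta> \<noteq> 0"
  proof (cases n)
    case 0
    then show ?thesis using a\<beta>n by simp
  next
    case (Suc m)
    then have "qpoch (a * \<beta>) s 1 \<noteq> 0"
      using qpoch_nonzero_le[OF assms(8), of 1] by (simp only: ab) simp
    then show ?thesis by (simp add: qpoch_def)
  qed
  \<comment> \<open>As e = a \<beta> s, 1 - e is the factor of index 1 in (a \<beta>; s)_n, present
    only for n >= 2. For n = 0 and n = 1 it comes from the denominators s - a b q^n and q - a b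
    s^n.\<close>
  have e1: "1 - e \<noteq> 0"
  proof -
    consider "n = 0" | "n = 1" | m where "n = Suc (Suc m)" by (metis One_nat_def not0_implies_Suc)
    then show ?thesis
    proof cases
      case 1
      then show ?thesis using assms(13) ab(2) by auto
    next
      case 2
      then show ?thesis using a\<beta>n e(1) by simp
    next
      case 3
      then have "qpoch (a * \<beta>) s 2 \<noteq> 0"
        using qpoch_nonzero_le[OF assms(8), of 2] by (simp only: ab) simp
      then show ?thesis by (simp add: qpoch_def numeral_2_eq_2 e(1))
    qed
  qed
  have en: "1 - e * q ^ n \<noteq> 0" and \<beta>1: "1 - \<beta> \<noteq> 0" "1 - \<beta> * s \<noteq> 0" and e\<beta>: "1 - e * \<beta> * q ^ n \<noteq> 0"
    using assms(10-13) by (auto simp: factored)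
  have eq0: "qpoch e q n \<noteq> 0"
    using qpoch_shift[of e q n] e1 denom(3)[of n] by auto

  have "qhyp [q powi (- int n), q * x, a, b, s powi (3 - 2 * int n) / (a * b)]
              [x, q powi (1 - int n) / a, q powi (2 - int n) / b, s * a * b] q q
    = (\<Sum>k\<le>n. (\<Prod>c\<leftarrow>[q powi (- int n), q * x, a, b, s powi (3 - 2 * int n) / (a * b)]. qpoch c q k)
       / qhyp_denom [x, q powi (1 - int n) / a, q powi (2 - int n) / b, s * a * b] q k * q ^ k)"
    unfolding qhyp_def
  \<comment> \<open>For k > n the factor of index n in (q^(-n); q)_k is zero, so the term is 0
    whatever its denominator, which is known to be nonzero only for k <= n.\<close>
  proof (rule suminf_finite)
    fix k assume "k \<notin> {..n}"
    then have "qpoch (q powi (- int n)) q k = 0"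
      using assms(1) by (auto simp: qpoch_def power_int_minus intro!: bexI[of _ n])
    then show "(\<Prod>c\<leftarrow>[q powi (- int n), q * x, a, b, s powi (3 - 2 * int n) / (a * b)]. qpoch c q k)
       / qhyp_denom [x, q powi (1 - int n) / a, q powi (2 - int n) / b, s * a * b] q k * q ^ k = 0"
      by simp
  qed simp
  also have "\<dots> = (\<Sum>k\<le>n. t k * (1 - x * q ^ k)) / (1 - x)"
    unfolding sum_divide_distrib
  proof (rule sum.cong)
    fix k assume "k \<in> {..n}"
    then have "qpoch (q * x) q k / qpoch x q k = (1 - x * q ^ k) / (1 - x)"
      using qpoch_shift[of x q k] denom(2)[of k] assms(9) by (simp add: frac_eq_eq mult_ac)
    moreover have "(\<Prod>c\<leftarrow>[q powi (- int n), q * x, a, b, s powi (3 - 2 * int n) / (a * b)]. qpoch c q k)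
       / qhyp_denom [x, q powi (1 - int n) / a, q powi (2 - int n) / b, s * a * b] q k * q ^ k
       = t k * (qpoch (q * x) q k / qpoch x q k)"
      by (simp add: t_def qhyp_denom_def mult_ac)
    ultimately show "(\<Prod>c\<leftarrow>[q powi (- int n), q * x, a, b, s powi (3 - 2 * int n) / (a * b)]. qpoch c q k)
       / qhyp_denom [x, q powi (1 - int n) / a, q powi (2 - int n) / b, s * a * b] q k * q ^ k
       = t k * (1 - x * q ^ k) / (1 - x)"
      by simp
  qed simp
  also have "(\<Sum>k\<le>n. t k * (1 - x * q ^ k)) = 1 / (qpoch a q n * qpoch \<beta> q n) * (qpoch q q n * qpoch e q n *
    (\<Sum>k\<le>n. qpoch a q k * qpoch a q (n - k) * qpoch b q k * qpoch \<beta> q (n - k)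
         / (qpoch q q k * qpoch q q (n - k) * qpoch (e * q) q k * qpoch e q (n - k)) / s ^ k * (1 - x * q ^ k)))"
    unfolding sum_distrib_left
  proof (rule sum.cong)
    fix k assume "k \<in> {..n}"
    then show "t k * (1 - x * q ^ k) = 1 / (qpoch a q n * qpoch \<beta> q n) * (qpoch q q n * qpoch e q n *
      (qpoch a q k * qpoch a q (n - k) * qpoch b q k * qpoch \<beta> q (n - k)
         / (qpoch q q k * qpoch q q (n - k) * qpoch (e * q) q k * qpoch e q (n - k)) / s ^ k * (1 - x * q ^ k)))"
      using summand_reversed[OF s assms(3,4), of k n] denom(1)[of n] assms(6,7) eq0
      by (simp add: t_def \<beta>_def e_def mult_ac flip: q)
  qed simp
  also have "qpoch q q n * qpoch e q n *
    (\<Sum>k\<le>n. qpoch a q k * qpoch a q (n - k) * qpoch b q k * qpoch \<beta> q (n - k)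
         / (qpoch q q k * qpoch q q (n - k) * qpoch (e * q) q k * qpoch e q (n - k)) / s ^ k * (1 - x * q ^ k))
    = qpoch (a * \<beta>) q n * (qpoch a s n * qpoch \<beta> s n * qpoch (- s) s n / qpoch (a * \<beta>) s n)
      * ((1 - e) * (1 - \<beta> * s ^ n) / (1 - e * \<beta> * q ^ n))
      * ((1 / s ^ n - x * \<beta> * s ^ n) / (1 - \<beta>)
         - (1 - \<beta> * s * s ^ n) * (x - e) * (1 - a * \<beta> * q ^ n)
           / ((1 - \<beta> * s) * (1 - e * q ^ n) * (1 - a * \<beta> * s ^ n)))"
    using reversed_sum[of s a \<beta> n x, unfolded e(1), folded q \<beta>(2)[folded q]]
      s assms(3,8) \<beta>(1) denom(1,3)[of n] eq0 e1 \<beta>1 a\<beta> a\<beta>n en e\<beta> by (simp add: ab)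
  also have "(1 / s ^ n - x * \<beta> * s ^ n) / (1 - \<beta>) = (s powi (2 - int n) - x * b * s ^ n) / (q - b)"
    using s \<beta>1 assms(11) by (simp add: \<beta>_def q power_int_diff frac_eq_eq) (simp add: field_simps)
  also have "(1 - \<beta> * s * s ^ n) * (x - e) * (1 - a * \<beta> * q ^ n)
           / ((1 - \<beta> * s) * (1 - e * q ^ n) * (1 - a * \<beta> * s ^ n))
    = (s - b * s ^ n) * (s * x - a * b) * (q - a * b * q ^ n)
           / ((s - b) * (s - a * b * q ^ n) * (q - a * b * s ^ n))"
    unfolding factored using s assms(1) by (simp add: mult.assoc)
  also have "(1 - e) * (1 - \<beta> * s ^ n) / (1 - e * \<beta> * q ^ n)
    = (s - a * b) * (q - b * s ^ n) / (s ^ 3 - a * b ^ 2 * q ^ n)"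
    unfolding factored ab(2) using s assms(1) by simp
  finally show ?thesis
    by (simp add: ab(1) \<beta>_def[symmetric] mult_ac)
qed

end
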